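(* Let $u_3=\phi(x,u,u_1,u_2)$ be a third-order ODE admitting Lie point symmetries $\mathbf v_1,\mathbf v_2,\mathbf v_3$ which form a basis of a Lie symmetry algebra isomorphic to $\mathfrak{sl}(2,\mathbb R)$, with $$[\mathbf v_1,\mathbf v_3]=\mathbf v_1,\qquad [\mathbf v_1,\mathbf v_2]=2\mathbf v_3,\qquad [\mathbf v_3,\mathbf v_2]=\mathbf v_2 .$$ Let $\mathbf A_{(x,u)}=\partial_x+u_1\partial_u+u_2\partial_{u_1}+\phi(x,u,u_1,u_2)\,\partial_{u_2}$ be the vector field associated to the ODE. Let $F_1$ and $F_2$ be two functions of $(x,u,u_1,u_2)$ satisfying $$\mathbf v_3^{(2)}(F_1)=F_1,\qquad \mathbf A_{(x,u)}(F_1)=0,\qquad \mathbf v_2^{(2)}(F_1)=0;$$ $$\mathbf v_3^{(2)}(F_2)=-F_2,\qquad \mathbf A_{(x,u)}(F_2)=0,\qquad \mathbf v_1^{(2)}(F_2)=0.$$ Then the ordered sets $$\big\langle \mathbf A_{(x,u)},\mathbf v_3^{(2)},F_1\mathbf v_1^{(2)},F_2\mathbf v_2^{(2)}\big\rangle\quad\text{and}\quad \big\langle \mathbf A_{(x,u)},\mathbf v_3^{(2)},F_2\mathbf v_2^{(2)},F_1\mathbf v_1^{(2)}\big\rangle$$ are solvable structures with respect to $\{\mathbf A_{(x,u)}\}$.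
   Context: All functions and vector fields are smooth on an open, simply connected set. $x$ is the independent variable, $u$ the dependent variable, $u_j=d^ju/dx^j$. For a vector field $\mathbf v=\xi(x,u)\partial_x+\eta(x,u)\partial_u$, $\mathbf v^{(2)}$ denotes its standard second-order prolongation to $(x,u,u_1,u_2)$-space. $\mathbf v$ is a Lie point symmetry of the ODE if and only if $[\mathbf v^{(2)},\mathbf A_{(x,u)}]=-\mathbf A_{(x,u)}(\xi)\,\mathbf A_{(x,u)}$. The vector fields $\mathbf A_{(x,u)},\mathbf v_1^{(2)},\mathbf v_2^{(2)},\mathbf v_3^{(2)}$ are taken to be independent on the four-dimensional space of variables $(x,u,u_1,u_2)$. For a system $\mathcal A=\{\mathbf A_1,\dots,\mathbf A_r\}$ of vector fields on an $n$-dimensional open set $D$, $\operatorname{span}(\mathcal A)$ is the set of linear combinations of its elements with coefficients in the smooth functions on $D$; $\mathcal A$ is in involution if $[\mathbf A_i,\mathbf A_j]\in\operatorname{span}(\mathcal A)$ for all $i,j$. Let $\mathcal A=\{\mathbf A_1,\dots,\mathbf A_r\}$, $r<n$, be independent and in involution. A vector field $\mathbf X$ is a symmetry of $\mathcal A$ if $\mathbf A_1,\dots,\mathbf A_r,\mathbf X$ are independent and $[\mathbf X,\mathbf A_i]\in\operatorname{span}(\mathcal A)$ for $1\le i\le r$. An ordered system $\langle\mathbf A_1,\dots,\mathbf A_r,\mathbf X_1,\dots,\mathbf X_{n-r}\rangle$, with $\mathbf X_1,\dots,\mathbf X_{n-r}$ independent, is a solvable structure with respect to $\mathcal A$ if: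 (a) $\mathcal S_j=\{\mathbf A_1,\dots,\mathbf A_r,\mathbf X_1,\dots,\mathbf X_j\}$ is in involution for $j=1,\dots,n-r$; (b) $\mathbf X_1$ is a symmetry of $\mathcal A$; (c) $\mathbf X_{j+1}$ is a symmetry of $\mathcal S_j$ for $j=1,\dots,n-r-1$. Here $n=4$ and $r=1$.
   Formalization: The functions F_1 and F_2 are additionally assumed to vanish nowhere on the domain; without this the claim fails (F_1 = 0 satisfies all the equations, but the system is then not independent), and pointwise independence in the conclusion forces it. *)

theory Defs
  imports "HOL-Analysis.Analysis"
begin

section \<open>Smooth functions on an open set\<close>

text \<open>Meant for open \<open>S\<close>. For a Euclidean domain, continuity of all iterated directional
  derivatives up to order \<open>k\<close> is the usual $C^k$ condition.\<close>

primrec Ck_on :: "nat \<Rightarrow> 'a::euclidean_space set \<Rightarrow> ('a \<Rightarrow> 'b::real_normed_vector) \<Rightarrow> bool" where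
  "Ck_on 0 S f \<longleftrightarrow> continuous_on S f"
| "Ck_on (Suc k) S f \<longleftrightarrow>
     (\<forall>p\<in>S. f differentiable (at p)) \<and> (\<forall>h. Ck_on k S (\<lambda>p. frechet_derivative f (at p) h))"

definition smooth_on :: "'a::euclidean_space set \<Rightarrow> ('a \<Rightarrow> 'b::real_normed_vector) \<Rightarrow> bool" where
  "smooth_on S f \<longleftrightarrow> (\<forall>k. Ck_on k S f)"

section \<open>Vector fields\<close>

text \<open>A vector field on an open subset of a Euclidean space \<open>'a\<close> is given by its coefficient
  function \<open>'a \<Rightarrow> 'a\<close>; only its values on the open set matter.\<close>

definition vf_apply :: "('a::euclidean_space \<Rightarrow> 'a) \<Rightarrow> ('a \<Rightarrow> 'b::real_normed_vector) \<Rightarrow> 'a \<Rightarrow> 'b" where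
  "vf_apply X f p = frechet_derivative f (at p) (X p)"

text \<open>The coefficients of $[X,Y] = XY - YX$ are $X(Y_i) - Y(X_i)$.\<close>

definition lie_bracket :: "('a::euclidean_space \<Rightarrow> 'a) \<Rightarrow> ('a \<Rightarrow> 'a) \<Rightarrow> 'a \<Rightarrow> 'a" where
  "lie_bracket X Y p = vf_apply X Y p - vf_apply Y X p"

definition vf_span :: "'a::euclidean_space set \<Rightarrow> ('a \<Rightarrow> 'a) list \<Rightarrow> ('a \<Rightarrow> 'a) set" where
  "vf_span D As = {X. \<exists>c :: nat \<Rightarrow> 'a \<Rightarrow> real. (\<forall>i<length As. smooth_on D (c i)) \<and>
      (\<forall>p\<in>D. X p = (\<Sum>i<length As. c i p *\<^sub>R (As ! i) p))}"

text \<open>Linear independence at every point of \<open>D\<close>. Distinctness is needed because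
  \<^const>\<open>independent\<close> is a property of sets, not of families.\<close>

definition vf_independent :: "'a::euclidean_space set \<Rightarrow> ('a \<Rightarrow> 'a) list \<Rightarrow> bool" where
  "vf_independent D As \<longleftrightarrow>
     (\<forall>p\<in>D. distinct (map (\<lambda>X. X p) As) \<and> independent (set (map (\<lambda>X. X p) As)))"

definition in_involution :: "'a::euclidean_space set \<Rightarrow> ('a \<Rightarrow> 'a) list \<Rightarrow> bool" where
  "in_involution D As \<longleftrightarrow> (\<forall>X\<in>set As. \<forall>Y\<in>set As. lie_bracket X Y \<in> vf_span D As)"

section \<open>Solvable structures\<close>

definition symmetry_of :: "'a::euclidean_space set \<Rightarrow> ('a \<Rightarrow> 'a) list \<Rightarrow> ('a \<Rightarrow> 'a) \<Rightarrow> bool" where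
  "symmetry_of D As X \<longleftrightarrow>
     vf_independent D (As @ [X]) \<and> (\<forall>A\<in>set As. lie_bracket X A \<in> vf_span D As)"

text \<open>\<open>Xs ! j\<close> is the field $X_{j+1}$, and \<open>As @ take j Xs\<close> is the system $S_j$.\<close>

definition solvable_structure ::
  "'a::euclidean_space set \<Rightarrow> ('a \<Rightarrow> 'a) list \<Rightarrow> ('a \<Rightarrow> 'a) list \<Rightarrow> bool" where
  "solvable_structure D As Xs \<longleftrightarrow>
     (\<forall>X\<in>set (As @ Xs). smooth_on D X) \<and>
     length As < DIM('a) \<and> length As + length Xs = DIM('a) \<and>
     vf_independent D As \<and> in_involution D As \<and>
     vf_independent D Xs \<and>
     (\<forall>j\<in>{1..length Xs}. in_involution D (As @ take j Xs)) \<and>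
     symmetry_of D As (Xs ! 0) \<and>
     (\<forall>j\<in>{1..<length Xs}. symmetry_of D (As @ take j Xs) (Xs ! j))"

section \<open>Third-order ordinary differential equations\<close>

type_synonym base = "real \<times> real"  \<comment> \<open>\<open>(x, u)\<close>\<close>
type_synonym jet1 = "real \<times> real \<times> real"  \<comment> \<open>\<open>(x, u, u1)\<close>\<close>
type_synonym jet2 = "real \<times> real \<times> real \<times> real"  \<comment> \<open>\<open>(x, u, u1, u2)\<close>\<close>

definition to_base :: "jet2 \<Rightarrow> base" where
  "to_base = (\<lambda>(x, u, u1, u2). (x, u))"

text \<open>The total derivative $D_x = \partial_x + u_1 \partial_u + u_2 \partial_{u_1} + \cdots$ on
  functions of \<open>(x, u)\<close> and of \<open>(x, u, u1)\<close>.\<close>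

definition total_deriv0 :: "(base \<Rightarrow> real) \<Rightarrow> jet1 \<Rightarrow> real" where
  "total_deriv0 f = (\<lambda>(x, u, u1). frechet_derivative f (at (x, u)) (1, u1))"

definition total_deriv1 :: "(jet1 \<Rightarrow> real) \<Rightarrow> jet2 \<Rightarrow> real" where
  "total_deriv1 f = (\<lambda>(x, u, u1, u2). frechet_derivative f (at (x, u, u1)) (1, u1, u2))"

text \<open>For $v = \xi \partial_x + \eta \partial_u$, these are
  $\eta^{(1)} = D_x \eta - u_1 D_x \xi$ and $\eta^{(2)} = D_x \eta^{(1)} - u_2 D_x \xi$.\<close>

definition prolong_coeff1 :: "(base \<Rightarrow> base) \<Rightarrow> jet1 \<Rightarrow> real" where
  "prolong_coeff1 v = (\<lambda>(x, u, u1).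
     total_deriv0 (\<lambda>q. snd (v q)) (x, u, u1) - u1 * total_deriv0 (\<lambda>q. fst (v q)) (x, u, u1))"

definition prolong_coeff2 :: "(base \<Rightarrow> base) \<Rightarrow> jet2 \<Rightarrow> real" where
  "prolong_coeff2 v = (\<lambda>(x, u, u1, u2).
     total_deriv1 (prolong_coeff1 v) (x, u, u1, u2) - u2 * total_deriv0 (\<lambda>q. fst (v q)) (x, u, u1))"

definition prolong2 :: "(base \<Rightarrow> base) \<Rightarrow> jet2 \<Rightarrow> jet2" where
  "prolong2 v = (\<lambda>(x, u, u1, u2).
     (fst (v (x, u)), snd (v (x, u)), prolong_coeff1 v (x, u, u1), prolong_coeff2 v (x, u, u1, u2)))"

definition ode_field :: "(jet2 \<Rightarrow> real) \<Rightarrow> jet2 \<Rightarrow> jet2" where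
  "ode_field \<phi> = (\<lambda>(x, u, u1, u2). (1, u1, u2, \<phi> (x, u, u1, u2)))"

text \<open>\<open>v\<close> is a Lie point symmetry of $u_3 = \phi$ on \<open>D\<close>: $[v^{(2)}, A] = -A(\xi) A$.\<close>

definition lie_point_symmetry :: "jet2 set \<Rightarrow> (jet2 \<Rightarrow> real) \<Rightarrow> (base \<Rightarrow> base) \<Rightarrow> bool" where
  "lie_point_symmetry D \<phi> v \<longleftrightarrow>
     (\<forall>p\<in>D. lie_bracket (prolong2 v) (ode_field \<phi>) p =
        - vf_apply (ode_field \<phi>) (\<lambda>p. fst (v (to_base p))) p *\<^sub>R ode_field \<phi> p)"

text \<open>Linear independence over the reals of vector fields on \<open>M\<close> (constant coefficients).\<close>

definition constant_independent3 ::
  "base set \<Rightarrow> (base \<Rightarrow> base) \<Rightarrow> (base \<Rightarrow> base) \<Rightarrow> (base \<Rightarrow> base) \<Rightarrow> bool" where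
  "constant_independent3 M v1 v2 v3 \<longleftrightarrow>
     (\<forall>a b c :: real. (\<forall>q\<in>M. a *\<^sub>R v1 q + b *\<^sub>R v2 q + c *\<^sub>R v3 q = 0) \<longrightarrow> a = 0 \<and> b = 0 \<and> c = 0)"

text \<open>Together with linear independence, the commutation relations make the real span of
  \<open>v1\<close>, \<open>v2\<close>, \<open>v3\<close> a Lie algebra isomorphic to $\mathfrak{sl}(2, \mathbb{R})$.\<close>

definition sl2_basis ::
  "base set \<Rightarrow> (base \<Rightarrow> base) \<Rightarrow> (base \<Rightarrow> base) \<Rightarrow> (base \<Rightarrow> base) \<Rightarrow> bool" where
  "sl2_basis M v1 v2 v3 \<longleftrightarrow> constant_independent3 M v1 v2 v3 \<and>
     (\<forall>q\<in>M. lie_bracket v1 v3 q = v1 q \<and>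
            lie_bracket v1 v2 q = 2 *\<^sub>R v3 q \<and>
            lie_bracket v3 v2 q = v2 q)"

end

(* The fields Y = F1 v1^(2) and Z = F2 v2^(2) are rescaled so that both commute with X = v3^(2), while
   [Z, Y] is a multiple of X; each of X, Y, Z brackets A into a multiple of A.  All the conditions of a
   solvable structure follow, for either order of Y and Z.

   The brackets of the prolonged fields come from those of v1, v2, v3 without any prolongation formula:
   by the Jacobi identity U = [v^(2), w^(2)] - k z^(2) satisfies [U, A] = c A, and if k z = [v, w] then U
   has no component along d/dx and d/du.  Comparing the components of [U, A] = c A in turn gives c = 0
   and then that the remaining two components of U vanish. *)
theory Submission
  imports Defs
begin

section \<open>Smooth functions\<close>

text \<open>Unscaled, the prolonged fields fail in every order: the first two would have to span,
  modulo A, a two-dimensional ideal, and sl(2,R) is simple. The rescaling removes exactly the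
  offending terms. In [F1 v1, v3] = F1 [v1, v3] - v3(F1) v1 the weight v3(F1) = F1 cancels [v1, v3]
  = v1, and the weight -1 of F2 does the same against [v3, v2] = v2. In [F2 v2, F1 v1] the
  correction terms carry v2(F1) and v1(F2), which vanish, so only -2 F1 F2 v3 is left; this is why
  v3 has to come first. A(F1) = A(F2) = 0 keeps the brackets with A along A. The analytic cost lies
  in the Jacobi identity, which rests on equality of mixed second derivatives. Smoothness is defined
  through iterated directional derivatives in constant directions, while vector fields differentiate
  in directions that vary with the point; expansions in the standard basis pass between the
  two.\<close>

lemma Ck_on_cong:
  assumes "open S" and "\<And>p. p \<in> S \<Longrightarrow> f p = g p" and "Ck_on k S f"
  shows "Ck_on k S g"
  using assms(2,3)
proof (induction k arbitrary: f g)
  case 0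
  then show ?case by (simp cong: continuous_on_cong)
next
  case (Suc k)
  have deriv: "(g has_derivative frechet_derivative f (at p)) (at p)" if "p \<in> S" for p
  proof (rule has_derivative_transform_within_open[OF _ \<open>open S\<close> that Suc.prems(1)])
    show "(f has_derivative frechet_derivative f (at p)) (at p)"
      using Suc.prems(2) that by (simp add: frechet_derivative_works)
  qed
  have "Ck_on k S (\<lambda>p. frechet_derivative g (at p) h)" for h
  proof (rule Suc.IH)
    show "Ck_on k S (\<lambda>p. frechet_derivative f (at p) h)"
      using Suc.prems by simp
  qed (simp add: frechet_derivative_at[OF deriv, symmetric])
  then show ?case
    using differentiableI[OF deriv] by simp
qed

text \<open>\<open>frechet_derivative\<close> is a choice operator, meaningful only where a
  derivative exists. Uniqueness of the derivative lets an explicit formula \<open>f'\<close> replace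
  it on S, and \<open>Ck_on_cong\<close> carries the replacement into the recursion.\<close>

lemma Ck_on_SucI:
  assumes "open S"
    and deriv: "\<And>p. p \<in> S \<Longrightarrow> (f has_derivative f' p) (at p)"
    and "\<And>h. Ck_on k S (\<lambda>p. f' p h)"
  shows "Ck_on (Suc k) S f"
proof -
  have "Ck_on k S (\<lambda>p. frechet_derivative f (at p) h)" for h
    by (rule Ck_on_cong[OF assms(1) _ assms(3)]) (simp add: frechet_derivative_at[OF deriv, symmetric])
  then show ?thesis
    using differentiableI[OF deriv] by simp
qed

lemma Ck_on_SucD:
  "Ck_on (Suc k) S f \<Longrightarrow> Ck_on k S f"
proof (induction k arbitrary: f)
  case 0
  then have "\<forall>p\<in>S. isCont f p"
    by (simp add: differentiable_imp_continuous_within)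
  then show ?case
    by (simp add: continuous_at_imp_continuous_on)
next
  case (Suc k)
  have "f differentiable (at p)" if "p \<in> S" for p
    using Suc.prems that by (simp only: Ck_on.simps(2))
  moreover have "Ck_on (Suc k) S (\<lambda>p. frechet_derivative f (at p) h)" for h
    using Suc.prems by (simp only: Ck_on.simps(2)[of "Suc k"])
  ultimately show ?case
    using Suc.IH by (simp only: Ck_on.simps(2)[of k] simp_thms) blast
qed

lemma Ck_on_imp_has_derivative:
  "Ck_on (Suc k) S f \<Longrightarrow> p \<in> S \<Longrightarrow> (f has_derivative frechet_derivative f (at p)) (at p)"
  by (simp add: frechet_derivative_works)

lemma Ck_on_const: "Ck_on k S (\<lambda>p. c)"
  by (induction k arbitrary: c) (simp_all)

lemma Ck_on_derivative: "Ck_on (Suc k) S f \<Longrightarrow> Ck_on k S (\<lambda>p. frechet_derivative f (at p) h)"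
  by simp

lemma Ck_on_add:
  assumes "open S" "Ck_on k S f" "Ck_on k S g"
  shows "Ck_on k S (\<lambda>p. f p + g p)"
  using assms(2,3)
proof (induction k arbitrary: f g)
  case 0
  then show ?case by (simp add: continuous_on_add)
next
  case (Suc k)
  show ?case
  proof (rule Ck_on_SucI[OF \<open>open S\<close>])
    show "((\<lambda>p. f p + g p) has_derivative
        (\<lambda>h. frechet_derivative f (at p) h + frechet_derivative g (at p) h)) (at p)" if "p \<in> S" for p
      using Suc.prems[THEN Ck_on_imp_has_derivative, OF that] by (rule has_derivative_add)
    show "Ck_on k S (\<lambda>p. frechet_derivative f (at p) h + frechet_derivative g (at p) h)" for h
      by (rule Suc.IH[OF Suc.prems[THEN Ck_on_derivative]])
  qed
qed

text \<open>The product rule pairs a derivative with an undifferentiated factor. The latter is one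
  order better than the induction hypothesis asks for, so \<open>Ck_on_SucD\<close> lowers it
  first.\<close>

lemma Ck_on_bilinear:
  assumes "bounded_bilinear B" "open S" "Ck_on k S f" "Ck_on k S g"
  shows "Ck_on k S (\<lambda>p. B (f p) (g p))"
  using assms(3,4)
proof (induction k arbitrary: f g)
  case 0
  then show ?case using bounded_bilinear.continuous_on[OF assms(1), of S f g] by simp
next
  case (Suc k)
  show ?case
  proof (rule Ck_on_SucI[OF \<open>open S\<close>])
    show "((\<lambda>p. B (f p) (g p)) has_derivative
        (\<lambda>h. B (f p) (frechet_derivative g (at p) h) + B (frechet_derivative f (at p) h) (g p))) (at p)"
      if "p \<in> S" for p
      using Suc.prems[THEN Ck_on_imp_has_derivative, OF that]
      by (rule bounded_bilinear.FDERIV[OF assms(1)])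
    show "Ck_on k S (\<lambda>p. B (f p) (frechet_derivative g (at p) h) + B (frechet_derivative f (at p) h) (g p))" for h
      by (rule Ck_on_add[OF \<open>open S\<close> Suc.IH[OF Ck_on_SucD[OF Suc.prems(1)] Ck_on_derivative[OF Suc.prems(2)]]
            Suc.IH[OF Ck_on_derivative[OF Suc.prems(1)] Ck_on_SucD[OF Suc.prems(2)]]])
  qed
qed

lemma Ck_on_linear:
  assumes "bounded_linear L" "open S" "Ck_on k S f"
  shows "Ck_on k S (\<lambda>p. L (f p))"
  using assms(3)
proof (induction k arbitrary: f)
  case 0
  then show ?case using bounded_linear.continuous_on[OF assms(1), of S f] by simp
next
  case (Suc k)
  show ?case
  proof (rule Ck_on_SucI[OF \<open>open S\<close>])
    show "((\<lambda>p. L (f p)) has_derivative (\<lambda>h. L (frechet_derivative f (at p) h))) (at p)" if "p \<in> S" for p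
      using Suc.prems[THEN Ck_on_imp_has_derivative, OF that] by (rule bounded_linear.has_derivative[OF assms(1)])
    show "Ck_on k S (\<lambda>p. L (frechet_derivative f (at p) h))" for h
      by (rule Suc.IH[OF Suc.prems[THEN Ck_on_derivative]])
  qed
qed

lemma has_derivative_compose_linear:
  assumes "bounded_linear L" "f differentiable (at (L p))"
  shows "((\<lambda>p. f (L p)) has_derivative (\<lambda>h. frechet_derivative f (at (L p)) (L h))) (at p)"
  by (rule has_derivative_compose[OF bounded_linear_imp_has_derivative[OF assms(1)]
        assms(2)[unfolded frechet_derivative_works]])

text \<open>For linear L the chain rule only replaces the direction h by the fixed direction L h, so
  the induction stays within functions of the form g o L. Coordinate projections between jet spaces
  are the only inner maps that occur later.\<close>

lemma Ck_on_compose_linear: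
  assumes "bounded_linear L" "open T" "L ` T \<subseteq> S" "Ck_on k S f"
  shows "Ck_on k T (\<lambda>p. f (L p))"
  using assms(4)
proof (induction k arbitrary: f)
  case 0
  then show ?case
    using continuous_on_compose2[OF _ linear_continuous_on[OF assms(1)] assms(3), of f] by simp
next
  case (Suc k)
  show ?case
  proof (rule Ck_on_SucI[OF \<open>open T\<close>])
    show "((\<lambda>p. f (L p)) has_derivative (\<lambda>h. frechet_derivative f (at (L p)) (L h))) (at p)" if "p \<in> T" for p
      using Suc.prems assms(3) that by (intro has_derivative_compose_linear[OF assms(1)]) auto
    show "Ck_on k T (\<lambda>p. frechet_derivative f (at (L p)) (L h))" for h
      by (rule Suc.IH[OF Suc.prems[THEN Ck_on_derivative]])
  qed
qed

section \<open>Closure properties of smooth maps\<close>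

lemma smooth_on_cong:
  "open S \<Longrightarrow> (\<And>p. p \<in> S \<Longrightarrow> f p = g p) \<Longrightarrow> smooth_on S f \<Longrightarrow> smooth_on S g"
  unfolding smooth_on_def using Ck_on_cong[of S f g] by blast

lemma smooth_on_const: "smooth_on S (\<lambda>p. c)"
  by (simp add: smooth_on_def Ck_on_const)

lemma smooth_on_id: "open S \<Longrightarrow> smooth_on S (\<lambda>p. p)"
proof -
  assume "open S"
  have "Ck_on k S (\<lambda>p. p)" for k
    by (cases k) (auto simp: Ck_on_const)
  then show ?thesis by (simp add: smooth_on_def)
qed

lemma smooth_on_add:
  "open S \<Longrightarrow> smooth_on S f \<Longrightarrow> smooth_on S g \<Longrightarrow> smooth_on S (\<lambda>p. f p + g p)"
  by (simp add: smooth_on_def Ck_on_add)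

lemma smooth_on_linear:
  "bounded_linear L \<Longrightarrow> open S \<Longrightarrow> smooth_on S f \<Longrightarrow> smooth_on S (\<lambda>p. L (f p))"
  unfolding smooth_on_def using Ck_on_linear[of L S _ f] by blast

lemma smooth_on_compose_linear:
  "bounded_linear L \<Longrightarrow> open T \<Longrightarrow> L ` T \<subseteq> S \<Longrightarrow> smooth_on S f \<Longrightarrow> smooth_on T (\<lambda>p. f (L p))"
  unfolding smooth_on_def using Ck_on_compose_linear[of L T S _ f] by blast

lemma smooth_on_scaleR:
  "open S \<Longrightarrow> smooth_on S f \<Longrightarrow> smooth_on S g \<Longrightarrow> smooth_on S (\<lambda>p. f p *\<^sub>R g p)"
  by (simp add: smooth_on_def Ck_on_bilinear[OF bounded_bilinear_scaleR])

lemma smooth_on_mult: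
  fixes f g :: "'a::euclidean_space \<Rightarrow> real"
  shows "open S \<Longrightarrow> smooth_on S f \<Longrightarrow> smooth_on S g \<Longrightarrow> smooth_on S (\<lambda>p. f p * g p)"
  using smooth_on_scaleR[of S f g] by simp

lemma smooth_on_minus:
  "open S \<Longrightarrow> smooth_on S f \<Longrightarrow> smooth_on S (\<lambda>p. - f p)"
  by (rule smooth_on_linear[OF bounded_linear_minus[OF bounded_linear_ident]])

lemma smooth_on_diff:
  "open S \<Longrightarrow> smooth_on S f \<Longrightarrow> smooth_on S g \<Longrightarrow> smooth_on S (\<lambda>p. f p - g p)"
  using smooth_on_add[OF _ _ smooth_on_minus, of S f g] by simp

text \<open>A pair is the sum of its two linear embeddings (y, 0) and (0, y).\<close>

lemma smooth_on_Pair: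
  fixes f :: "'a::euclidean_space \<Rightarrow> 'b::real_normed_vector" and g :: "'a \<Rightarrow> 'c::real_normed_vector"
  assumes "open S" "smooth_on S f" "smooth_on S g"
  shows "smooth_on S (\<lambda>p. (f p, g p))"
proof -
  have "bounded_linear (\<lambda>y :: 'b. (y, 0 :: 'c))" "bounded_linear (\<lambda>y :: 'c. (0 :: 'b, y))"
    by (auto intro: bounded_linear_Pair bounded_linear_ident bounded_linear_zero)
  from smooth_on_add[OF assms(1) smooth_on_linear[OF this(1) assms(1,2)] smooth_on_linear[OF this(2) assms(1,3)]]
  show ?thesis by simp
qed

lemmas smooth_on_fst = smooth_on_linear[OF bounded_linear_fst]
lemmas smooth_on_snd = smooth_on_linear[OF bounded_linear_snd]

lemma smooth_on_sum:
  "open S \<Longrightarrow> (\<And>i. i \<in> I \<Longrightarrow> smooth_on S (f i)) \<Longrightarrow> smooth_on S (\<lambda>p. \<Sum>i\<in>I. f i p)"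
  by (induction I rule: infinite_finite_induct) (simp_all add: smooth_on_add smooth_on_const)

lemma smooth_on_differentiable: "smooth_on S f \<Longrightarrow> p \<in> S \<Longrightarrow> f differentiable (at p)"
  unfolding smooth_on_def by (drule spec[of _ "Suc 0"]) simp

lemma smooth_on_has_derivative:
  "smooth_on S f \<Longrightarrow> p \<in> S \<Longrightarrow> (f has_derivative frechet_derivative f (at p)) (at p)"
  using smooth_on_differentiable[of S f p] frechet_derivative_works by blast

lemma smooth_on_derivative:
  assumes "smooth_on S f"
  shows "smooth_on S (\<lambda>p. frechet_derivative f (at p) h)"
  unfolding smooth_on_def
proof
  fix k
  have "Ck_on (Suc k) S f" using assms by (simp only: smooth_on_def)
  then show "Ck_on k S (\<lambda>p. frechet_derivative f (at p) h)" by simp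
qed

text \<open>Used to trade a direction that varies with the point for the finitely many constant
  directions that \<open>smooth_on\<close> controls.\<close>

lemma frechet_derivative_basis:
  assumes "f differentiable (at p)"
  shows "frechet_derivative f (at p) h = (\<Sum>b\<in>Basis. (h \<bullet> b) *\<^sub>R frechet_derivative f (at p) b)"
proof -
  interpret linear "frechet_derivative f (at p)" by (rule linear_frechet_derivative[OF assms])
  have "frechet_derivative f (at p) (\<Sum>b\<in>Basis. (h \<bullet> b) *\<^sub>R b) =
      (\<Sum>b\<in>Basis. (h \<bullet> b) *\<^sub>R frechet_derivative f (at p) b)"
    by (simp only: sum scale)
  then show ?thesis by (simp only: euclidean_representation)
qed

lemma smooth_on_vf_apply:
  assumes "open S" "smooth_on S X" "smooth_on S f"
  shows "smooth_on S (vf_apply X f)"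
proof (rule smooth_on_cong[OF \<open>open S\<close>])
  show "smooth_on S (\<lambda>p. \<Sum>b\<in>Basis. (X p \<bullet> b) *\<^sub>R frechet_derivative f (at p) b)"
    using assms by (intro smooth_on_sum smooth_on_scaleR smooth_on_derivative
        smooth_on_linear[OF bounded_linear_inner_left])
  show "(\<Sum>b\<in>Basis. (X p \<bullet> b) *\<^sub>R frechet_derivative f (at p) b) = vf_apply X f p" if "p \<in> S" for p
    unfolding vf_apply_def
    using frechet_derivative_basis[OF smooth_on_differentiable[OF assms(3) that], of "X p"] by (rule sym)
qed

lemma smooth_on_lie_bracket:
  "open S \<Longrightarrow> smooth_on S X \<Longrightarrow> smooth_on S Y \<Longrightarrow> smooth_on S (lie_bracket X Y)"
  unfolding lie_bracket_def[abs_def] by (intro smooth_on_diff smooth_on_vf_apply)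

section \<open>Equality of mixed second derivatives\<close>

text \<open>Two applications of the mean value theorem: one along h to the difference of f on two
  parallel edges of the parallelogram, one along k to the resulting difference of
  h-derivatives.\<close>

lemma second_difference_mean_value:
  fixes f :: "'a::euclidean_space \<Rightarrow> real"
  assumes sub: "\<And>a b. 0 \<le> a \<Longrightarrow> a \<le> t \<Longrightarrow> 0 \<le> b \<Longrightarrow> b \<le> t \<Longrightarrow> p + a *\<^sub>R h + b *\<^sub>R k \<in> S"
    and "t > 0" and "smooth_on S f"
  shows "\<exists>a b. 0 < a \<and> a < t \<and> 0 < b \<and> b < t \<and>
    f (p + t *\<^sub>R h + t *\<^sub>R k) - f (p + t *\<^sub>R h) - f (p + t *\<^sub>R k) + f p =
    t * t * frechet_derivative (\<lambda>q. frechet_derivative f (at q) h) (at (p + a *\<^sub>R h + b *\<^sub>R k)) k"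
proof -
  have line: "DERIV (\<lambda>s. g (q + s *\<^sub>R v)) s :> frechet_derivative g (at (q + s *\<^sub>R v)) v"
    if g: "smooth_on S g" and q: "q + s *\<^sub>R v \<in> S" for g :: "'a \<Rightarrow> real" and q v s
  proof -
    have "((\<lambda>s. q + s *\<^sub>R v) has_derivative (\<lambda>r. r *\<^sub>R v)) (at s)"
      by (auto intro!: derivative_eq_intros)
    from has_derivative_compose[OF this smooth_on_has_derivative[OF g q]]
    show ?thesis
      using linear_scale[OF linear_frechet_derivative[OF smooth_on_differentiable[OF g q]]]
      by (simp add: has_field_derivative_def mult.commute[of _ "frechet_derivative _ _ _"] mult_commute_abs)
  qed
  let ?Dh = "\<lambda>q. frechet_derivative f (at q) h"
  \<comment> \<open>The second difference in the goal is \<open>\<psi> t - \<psi> 0\<close>.\<close>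
  define \<psi> where "\<psi> s = f (p + t *\<^sub>R k + s *\<^sub>R h) - f (p + s *\<^sub>R h)" for s
  have "DERIV \<psi> s :> ?Dh (p + t *\<^sub>R k + s *\<^sub>R h) - ?Dh (p + s *\<^sub>R h)"
    if "0 \<le> s" "s \<le> t" for s
    unfolding \<psi>_def
    using sub[of s t] sub[of s 0] that \<open>t > 0\<close>
    by (intro DERIV_diff line \<open>smooth_on S f\<close>) (auto simp: algebra_simps)
  from MVT2[OF \<open>t > 0\<close> this] obtain a where a: "0 < a" "a < t"
    "\<psi> t - \<psi> 0 = t * (?Dh (p + t *\<^sub>R k + a *\<^sub>R h) - ?Dh (p + a *\<^sub>R h))"
    by auto
  have "DERIV (\<lambda>s. ?Dh (p + a *\<^sub>R h + s *\<^sub>R k)) s :>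
      frechet_derivative ?Dh (at (p + a *\<^sub>R h + s *\<^sub>R k)) k" if "0 \<le> s" "s \<le> t" for s
    using sub[of a s] a that by (intro line smooth_on_derivative \<open>smooth_on S f\<close>) auto
  from MVT2[OF \<open>t > 0\<close> this] obtain b where b: "0 < b" "b < t"
    "?Dh (p + a *\<^sub>R h + t *\<^sub>R k) - ?Dh (p + a *\<^sub>R h) =
      t * frechet_derivative ?Dh (at (p + a *\<^sub>R h + b *\<^sub>R k)) k"
    by auto
  show ?thesis
    using a b by (intro exI[of _ a] exI[of _ b]) (simp add: \<psi>_def algebra_simps)
qed

text \<open>The second difference is symmetric in h and k. Hence the two mixed derivatives agree at
  some pair of points arbitrarily near p, and continuity of both at p brings their values there
  within any e of each other.\<close>

lemma symmetric_second_derivative_real: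
  fixes f :: "'a::euclidean_space \<Rightarrow> real"
  assumes "open S" "smooth_on S f" "p \<in> S"
  shows "frechet_derivative (\<lambda>q. frechet_derivative f (at q) h) (at p) k =
    frechet_derivative (\<lambda>q. frechet_derivative f (at q) k) (at p) h"
    (is "?H p = ?K p")
proof -
  from \<open>open S\<close> \<open>p \<in> S\<close> obtain r where r: "r > 0" "ball p r \<subseteq> S"
    using open_contains_ball by blast
  have close: "norm (a *\<^sub>R u + b *\<^sub>R v) \<le> t * (norm u + norm v)"
    if "0 \<le> a" "a \<le> t" "0 \<le> b" "b \<le> t" for a b t and u v :: 'a
  proof -
    have "norm (a *\<^sub>R u + b *\<^sub>R v) \<le> a * norm u + b * norm v"
      using norm_triangle_ineq[of "a *\<^sub>R u" "b *\<^sub>R v"] that by simp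
    also have "\<dots> \<le> t * norm u + t * norm v"
      using that by (intro add_mono mult_right_mono) auto
    finally show ?thesis by (simp add: distrib_left)
  qed
  \<comment> \<open>The summand 1 makes N positive even for h = k = 0 and makes norm h + norm k < N
    strict.\<close>
  define N where "N = norm h + norm k + 1"
  have N: "N > 0" by (simp add: N_def add_nonneg_pos)
  have lt: "t * (norm u + norm v) < d" if "0 < t" "t < d / N" "norm u + norm v < N" for t d and u v :: 'a
    using that N by (smt (verit) mult_strict_left_mono pos_less_divide_eq)
  have cont: "isCont (\<lambda>q. frechet_derivative (\<lambda>q. frechet_derivative f (at q) u) (at q) v) p" for u v
    using smooth_on_differentiable[OF smooth_on_derivative[OF smooth_on_derivative[OF assms(2)]] assms(3)]
    by (rule differentiable_imp_continuous_within)
  have "\<bar>?H p - ?K p\<bar> \<le> e" if "e > 0" for e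
  proof -
    from cont[of h k] \<open>e > 0\<close> obtain d1 where d1: "d1 > 0"
      "\<And>q. dist q p < d1 \<Longrightarrow> \<bar>?H q - ?H p\<bar> < e / 2"
      unfolding continuous_at_eps_delta dist_real_def by (meson half_gt_zero)
    from cont[of k h] \<open>e > 0\<close> obtain d2 where d2: "d2 > 0"
      "\<And>q. dist q p < d2 \<Longrightarrow> \<bar>?K q - ?K p\<bar> < e / 2"
      unfolding continuous_at_eps_delta dist_real_def by (meson half_gt_zero)
    define d where "d = min r (min d1 d2)"
    have "d > 0" using r d1 d2 by (simp add: d_def)
    \<comment> \<open>Since t N < d, the whole parallelogram of side parameter t lies within d of p,
      hence inside S and within the range of both continuity estimates.\<close>
    define t where "t = d / N / 2"
    have "d / N > 0" using \<open>d > 0\<close> N by simp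
    moreover have "x / 2 < x" if "x > 0" for x :: real
      using that by simp
    ultimately have t: "0 < t" "t < d / N"
      unfolding t_def by (simp_all only: half_gt_zero_iff)
    have near: "dist (p + a *\<^sub>R u + b *\<^sub>R v) p < d"
      if "0 \<le> a" "a \<le> t" "0 \<le> b" "b \<le> t" "norm u + norm v < N" for a b and u v :: 'a
      using close[OF that(1-4), of u v] lt[OF t that(5)] by (simp add: dist_norm add.assoc)
    have sub: "p + a *\<^sub>R u + b *\<^sub>R v \<in> S"
      if "0 \<le> a" "a \<le> t" "0 \<le> b" "b \<le> t" "norm u + norm v < N" for a b and u v :: 'a
      using near[OF that] r by (auto simp: d_def dist_commute subset_iff)
    have lth: "norm h + norm k < N" "norm k + norm h < N" by (auto simp: N_def)
    obtain a b where ab: "0 < a" "a < t" "0 < b" "b < t"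
      "f (p + t *\<^sub>R h + t *\<^sub>R k) - f (p + t *\<^sub>R h) - f (p + t *\<^sub>R k) + f p =
        t * t * ?H (p + a *\<^sub>R h + b *\<^sub>R k)"
      using second_difference_mean_value[OF sub \<open>0 < t\<close> assms(2)] lth by blast
    obtain a' b' where ab': "0 < a'" "a' < t" "0 < b'" "b' < t"
      "f (p + t *\<^sub>R k + t *\<^sub>R h) - f (p + t *\<^sub>R k) - f (p + t *\<^sub>R h) + f p =
        t * t * ?K (p + a' *\<^sub>R k + b' *\<^sub>R h)"
      using second_difference_mean_value[OF sub \<open>0 < t\<close> assms(2)] lth by blast
    have "t * t * ?H (p + a *\<^sub>R h + b *\<^sub>R k) = t * t * ?K (p + a' *\<^sub>R k + b' *\<^sub>R h)"
      using ab(5) ab'(5) by (simp add: algebra_simps)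
    then have "?H (p + a *\<^sub>R h + b *\<^sub>R k) = ?K (p + a' *\<^sub>R k + b' *\<^sub>R h)"
      using t by simp
    moreover have "\<bar>?H (p + a *\<^sub>R h + b *\<^sub>R k) - ?H p\<bar> < e / 2"
      using near[of a b h k] ab lth by (intro d1) (auto simp: d_def)
    moreover have "\<bar>?K (p + a' *\<^sub>R k + b' *\<^sub>R h) - ?K p\<bar> < e / 2"
      using near[of a' b' k h] ab' lth by (intro d2) (auto simp: d_def)
    ultimately show ?thesis by linarith
  qed
  then show ?thesis
    using field_le_epsilon[of "\<bar>?H p - ?K p\<bar>" 0] by auto
qed

lemma frechet_derivative_linear:
  assumes "bounded_linear L" "f differentiable (at p)"
  shows "frechet_derivative (\<lambda>q. L (f q)) (at p) h = L (frechet_derivative f (at p) h)"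
  by (simp only: frechet_derivative_at[OF bounded_linear.has_derivative[OF assms(1)
        assms(2)[unfolded frechet_derivative_works]], symmetric])

text \<open>Reduces to real functions through the components f . b. The inner product passes through
  the inner derivative only at points of S, so moving it through the outer one needs S open.\<close>

lemma symmetric_second_derivative:
  fixes f :: "'a::euclidean_space \<Rightarrow> 'b::euclidean_space"
  assumes "open S" "smooth_on S f" "p \<in> S"
  shows "frechet_derivative (\<lambda>q. frechet_derivative f (at q) h) (at p) k =
    frechet_derivative (\<lambda>q. frechet_derivative f (at q) k) (at p) h"
proof (rule euclidean_eqI)
  fix b :: 'b assume "b \<in> Basis"
  have smooth_comp: "smooth_on S (\<lambda>q. f q \<bullet> b)"
    by (rule smooth_on_linear[OF bounded_linear_inner_left assms(1,2)])
  have comp: "frechet_derivative (\<lambda>q. frechet_derivative (\<lambda>q. f q \<bullet> b) (at q) u) (at p) v =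
      frechet_derivative (\<lambda>q. frechet_derivative f (at q) u) (at p) v \<bullet> b" for u v
  proof -
    have "frechet_derivative (\<lambda>q. frechet_derivative (\<lambda>q. f q \<bullet> b) (at q) u) (at p) =
        frechet_derivative (\<lambda>q. frechet_derivative f (at q) u \<bullet> b) (at p)"
    proof (rule frechet_derivative_transform_within_open[OF _ assms(1,3)])
      show "(\<lambda>q. frechet_derivative (\<lambda>q. f q \<bullet> b) (at q) u) differentiable at p"
        by (rule smooth_on_differentiable[OF smooth_on_derivative[OF smooth_comp] assms(3)])
      show "frechet_derivative (\<lambda>q. f q \<bullet> b) (at q) u = frechet_derivative f (at q) u \<bullet> b"
        if "q \<in> S" for q
        by (rule frechet_derivative_linear[OF bounded_linear_inner_left
              smooth_on_differentiable[OF assms(2) that]])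
    qed
    then show ?thesis
      using frechet_derivative_linear[OF bounded_linear_inner_left
            smooth_on_differentiable[OF smooth_on_derivative[OF assms(2)] assms(3)]]
      by simp
  qed
  show "frechet_derivative (\<lambda>q. frechet_derivative f (at q) h) (at p) k \<bullet> b =
      frechet_derivative (\<lambda>q. frechet_derivative f (at q) k) (at p) h \<bullet> b"
    unfolding comp[symmetric]
    by (rule symmetric_second_derivative_real[OF assms(1) smooth_comp assms(3)])
qed

section \<open>Calculus of vector fields\<close>

lemma vf_apply_cong:
  assumes "open S" "p \<in> S" "f differentiable (at p)" "\<And>q. q \<in> S \<Longrightarrow> f q = g q"
  shows "vf_apply X f p = vf_apply X g p"
  unfolding vf_apply_def
  by (simp only: frechet_derivative_transform_within_open[OF assms(3,1,2,4)])

lemma vf_apply_add: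
  assumes "f differentiable (at p)" "g differentiable (at p)"
  shows "vf_apply X (\<lambda>q. f q + g q) p = vf_apply X f p + vf_apply X g p"
  by (simp only: vf_apply_def
      frechet_derivative_at[OF has_derivative_add[OF assms[unfolded frechet_derivative_works]], symmetric])

lemma vf_apply_diff:
  assumes "f differentiable (at p)" "g differentiable (at p)"
  shows "vf_apply X (\<lambda>q. f q - g q) p = vf_apply X f p - vf_apply X g p"
  by (simp only: vf_apply_def
      frechet_derivative_at[OF has_derivative_diff[OF assms[unfolded frechet_derivative_works]], symmetric])

lemma vf_apply_scaleR:
  assumes "f differentiable (at p)" "g differentiable (at p)"
  shows "vf_apply X (\<lambda>q. f q *\<^sub>R g q) p = vf_apply X f p *\<^sub>R g p + f p *\<^sub>R vf_apply X g p"
  by (simp only: vf_apply_def add.commute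
      frechet_derivative_at[OF has_derivative_scaleR[OF assms[unfolded frechet_derivative_works]], symmetric])

lemma vf_apply_linear:
  assumes "bounded_linear L" "f differentiable (at p)"
  shows "vf_apply X (\<lambda>q. L (f q)) p = L (vf_apply X f p)"
  unfolding vf_apply_def by (rule frechet_derivative_linear[OF assms])

lemma vf_apply_const: "vf_apply X (\<lambda>q. c) p = 0"
  by (simp add: vf_apply_def)

lemma vf_apply_field_diff:
  assumes "f differentiable (at p)"
  shows "vf_apply (\<lambda>q. X q - Y q) f p = vf_apply X f p - vf_apply Y f p"
  unfolding vf_apply_def by (rule linear_diff[OF linear_frechet_derivative[OF assms]])

lemma vf_apply_field_scaleR:
  assumes "f differentiable (at p)"
  shows "vf_apply (\<lambda>q. a q *\<^sub>R X q) f p = a p *\<^sub>R vf_apply X f p"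
  unfolding vf_apply_def by (rule linear_scale[OF linear_frechet_derivative[OF assms]])

text \<open>X(Y f) = Df(DY X) + D^2 f(Y, X). The first-order terms assemble to the bracket and the
  second-order terms cancel by symmetry.\<close>

lemma vf_apply_lie_bracket:
  fixes f :: "'a::euclidean_space \<Rightarrow> 'b::euclidean_space"
  assumes "open S" "smooth_on S X" "smooth_on S Y" "smooth_on S f" "p \<in> S"
  shows "vf_apply (lie_bracket X Y) f p = vf_apply X (vf_apply Y f) p - vf_apply Y (vf_apply X f) p"
proof -
  let ?F = "\<lambda>q. frechet_derivative f (at q)"
  have lin: "linear (?F q)" if "q \<in> S" for q
    by (rule linear_frechet_derivative[OF smooth_on_differentiable[OF assms(4) that]])
  have second: "vf_apply X (vf_apply Y f) p =
      ?F p (vf_apply X Y p) + frechet_derivative (\<lambda>q. ?F q (Y p)) (at p) (X p)"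
    if "smooth_on S X" "smooth_on S Y" for X Y
  proof -
    have dY: "Y differentiable (at p)"
      by (rule smooth_on_differentiable[OF that(2) assms(5)])
    have dF: "(\<lambda>q. ?F q b) differentiable (at p)" for b
      by (rule smooth_on_differentiable[OF smooth_on_derivative[OF assms(4)] assms(5)])
    have df: "f differentiable (at q)" if "q \<in> S" for q
      by (rule smooth_on_differentiable[OF assms(4) that])
    \<comment> \<open>The direction Y q moves with q, so the product rule is applied to each basis
      term. The second sum collects the terms with Y frozen at p.\<close>
    have expand: "vf_apply X (\<lambda>q. \<Sum>b\<in>B. (Y q \<bullet> b) *\<^sub>R ?F q b) p =
        (\<Sum>b\<in>B. (vf_apply X Y p \<bullet> b) *\<^sub>R ?F p b) +
        (\<Sum>b\<in>B. (Y p \<bullet> b) *\<^sub>R frechet_derivative (\<lambda>q. ?F q b) (at p) (X p))"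
      if "finite B" for B
      using that
    proof induction
      case empty
      then show ?case by (simp add: vf_apply_const)
    next
      case (insert c B)
      have dc: "(\<lambda>q. (Y q \<bullet> b) *\<^sub>R ?F q b) differentiable (at p)" for b
        using dY dF by (intro differentiable_scaleR differentiable_inner differentiable_const)
      have "vf_apply X (\<lambda>q. (Y q \<bullet> c) *\<^sub>R ?F q c) p = (vf_apply X Y p \<bullet> c) *\<^sub>R ?F p c +
          (Y p \<bullet> c) *\<^sub>R frechet_derivative (\<lambda>q. ?F q c) (at p) (X p)"
        using dY dF by (subst vf_apply_scaleR)
          (auto simp: vf_apply_linear[OF bounded_linear_inner_left] vf_apply_def[of X "\<lambda>q. ?F q c"]
            intro!: differentiable_inner differentiable_const)
      then show ?case
        using insert dc by (simp add: vf_apply_add differentiable_sum)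
    qed
    have "vf_apply X (vf_apply Y f) p = vf_apply X (\<lambda>q. \<Sum>b\<in>Basis. (Y q \<bullet> b) *\<^sub>R ?F q b) p"
    proof (rule vf_apply_cong[OF assms(1,5)])
      show "vf_apply Y f differentiable (at p)"
        by (rule smooth_on_differentiable[OF smooth_on_vf_apply[OF assms(1) that(2) assms(4)] assms(5)])
      show "vf_apply Y f q = (\<Sum>b\<in>Basis. (Y q \<bullet> b) *\<^sub>R ?F q b)" if "q \<in> S" for q
        unfolding vf_apply_def by (rule frechet_derivative_basis[OF df[OF that]])
    qed
    also have "\<dots> = ?F p (vf_apply X Y p) +
        (\<Sum>b\<in>Basis. (Y p \<bullet> b) *\<^sub>R frechet_derivative (\<lambda>q. ?F q b) (at p) (X p))"
      by (simp only: expand[OF finite_Basis] frechet_derivative_basis[OF df[OF assms(5)], of "vf_apply X Y p"])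
    \<comment> \<open>The basis vectors sit in the inner derivative. Symmetry moves them to the
      outer one, where linearity collapses the sum; the next step swaps back.\<close>
    also have "(\<Sum>b\<in>Basis. (Y p \<bullet> b) *\<^sub>R frechet_derivative (\<lambda>q. ?F q b) (at p) (X p)) =
        frechet_derivative (\<lambda>q. ?F q (X p)) (at p) (Y p)"
      by (simp only: frechet_derivative_basis[OF dF, of _ "Y p"]
          symmetric_second_derivative[OF assms(1,4,5), of _ "X p"])
    also have "\<dots> = frechet_derivative (\<lambda>q. ?F q (Y p)) (at p) (X p)"
      by (rule symmetric_second_derivative[OF assms(1,4,5)])
    finally show ?thesis .
  qed
  have "vf_apply (lie_bracket X Y) f p = ?F p (vf_apply X Y p) - ?F p (vf_apply Y X p)"
    by (simp only: vf_apply_def[of "lie_bracket X Y"] lie_bracket_def linear_diff[OF lin[OF assms(5)]])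
  then show ?thesis
    using second[OF assms(2,3)] second[OF assms(3,2)]
      symmetric_second_derivative[OF assms(1,4,5), of "X p" "Y p"]
    by simp
qed

section \<open>Lie brackets: Leibniz rules and the Jacobi identity\<close>

lemma lie_bracket_self: "lie_bracket X X p = 0"
  by (simp add: lie_bracket_def)

lemma lie_bracket_swap: "lie_bracket X Y p = - lie_bracket Y X p"
  by (simp add: lie_bracket_def)

lemma lie_bracket_scaleR_left:
  assumes "f differentiable (at p)" "X differentiable (at p)" "Y differentiable (at p)"
  shows "lie_bracket (\<lambda>q. f q *\<^sub>R X q) Y p = f p *\<^sub>R lie_bracket X Y p - vf_apply Y f p *\<^sub>R X p"
  using assms by (simp add: lie_bracket_def vf_apply_scaleR vf_apply_field_scaleR algebra_simps)

lemma lie_bracket_diff_left: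
  assumes "X differentiable (at p)" "X' differentiable (at p)" "Y differentiable (at p)"
  shows "lie_bracket (\<lambda>q. X q - X' q) Y p = lie_bracket X Y p - lie_bracket X' Y p"
  using assms by (simp add: lie_bracket_def vf_apply_diff vf_apply_field_diff)

text \<open>The Jacobi identity for V, W, A. Expanding [V, b A] - [W, a A] produces, besides the
  derivatives of a and b, the terms b a A and -a b A, which cancel.\<close>

lemma lie_bracket_of_symmetries:
  fixes V W A :: "'a::euclidean_space \<Rightarrow> 'a"
  assumes "open S" "smooth_on S V" "smooth_on S W" "smooth_on S A" "smooth_on S a" "smooth_on S b"
    and VA: "\<And>q. q \<in> S \<Longrightarrow> lie_bracket V A q = a q *\<^sub>R A q"
    and WA: "\<And>q. q \<in> S \<Longrightarrow> lie_bracket W A q = b q *\<^sub>R A q"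
    and "p \<in> S"
  shows "lie_bracket (lie_bracket V W) A p = (vf_apply V b p - vf_apply W a p) *\<^sub>R A p"
proof -
  note sm = assms(1-6) smooth_on_vf_apply
  have d: "f differentiable (at p)" if "smooth_on S f" for f :: "'a \<Rightarrow> 'a"
    using that \<open>p \<in> S\<close> by (rule smooth_on_differentiable)
  have dr: "f differentiable (at p)" if "smooth_on S f" for f :: "'a \<Rightarrow> real"
    using that \<open>p \<in> S\<close> by (rule smooth_on_differentiable)
  have A_V: "vf_apply V A q - vf_apply A V q = a q *\<^sub>R A q"
    and A_W: "vf_apply W A q - vf_apply A W q = b q *\<^sub>R A q" if "q \<in> S" for q
    using VA[OF that] WA[OF that] by (auto simp: lie_bracket_def)
  have "vf_apply V (vf_apply W A) p - vf_apply V (vf_apply A W) p =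
      vf_apply V (\<lambda>q. vf_apply W A q - vf_apply A W q) p"
    using sm by (intro vf_apply_diff[symmetric] d) auto
  also have "\<dots> = vf_apply V (\<lambda>q. b q *\<^sub>R A q) p"
    using sm A_W by (intro vf_apply_cong[OF assms(1,9)] d smooth_on_diff) auto
  also have "\<dots> = vf_apply V b p *\<^sub>R A p + b p *\<^sub>R vf_apply V A p"
    using sm by (intro vf_apply_scaleR d dr)
  finally have V: "vf_apply V (vf_apply W A) p = vf_apply V (vf_apply A W) p +
      vf_apply V b p *\<^sub>R A p + b p *\<^sub>R vf_apply V A p"
    by (simp add: algebra_simps)
  have "vf_apply W (vf_apply V A) p - vf_apply W (vf_apply A V) p =
      vf_apply W (\<lambda>q. vf_apply V A q - vf_apply A V q) p"
    using sm by (intro vf_apply_diff[symmetric] d) auto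
  also have "\<dots> = vf_apply W (\<lambda>q. a q *\<^sub>R A q) p"
    using sm A_V by (intro vf_apply_cong[OF assms(1,9)] d smooth_on_diff) auto
  also have "\<dots> = vf_apply W a p *\<^sub>R A p + a p *\<^sub>R vf_apply W A p"
    using sm by (intro vf_apply_scaleR d dr)
  finally have W: "vf_apply W (vf_apply V A) p = vf_apply W (vf_apply A V) p +
      vf_apply W a p *\<^sub>R A p + a p *\<^sub>R vf_apply W A p"
    by (simp add: algebra_simps)
  \<comment> \<open>Coefficient maps are vector-valued functions, so the fields act on them as
    operators; these identities are used with f = W and f = V.\<close>
  have bracket_apply: "a p *\<^sub>R vf_apply A f p = vf_apply V (vf_apply A f) p - vf_apply A (vf_apply V f) p"
    "b p *\<^sub>R vf_apply A f p = vf_apply W (vf_apply A f) p - vf_apply A (vf_apply W f) p"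
    if f: "smooth_on S f" for f :: "'a \<Rightarrow> 'a"
  proof -
    have "vf_apply (lie_bracket V A) f p = a p *\<^sub>R vf_apply A f p"
      "vf_apply (lie_bracket W A) f p = b p *\<^sub>R vf_apply A f p"
      using VA[OF \<open>p \<in> S\<close>] WA[OF \<open>p \<in> S\<close>]
        linear_scale[OF linear_frechet_derivative[OF d[OF f]]]
      by (auto simp: vf_apply_def)
    then show "a p *\<^sub>R vf_apply A f p = vf_apply V (vf_apply A f) p - vf_apply A (vf_apply V f) p"
      "b p *\<^sub>R vf_apply A f p = vf_apply W (vf_apply A f) p - vf_apply A (vf_apply W f) p"
      using vf_apply_lie_bracket[OF assms(1) _ _ f \<open>p \<in> S\<close>] sm by metis+
  qed
  have "lie_bracket (lie_bracket V W) A p =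
      vf_apply V (vf_apply W A) p - vf_apply W (vf_apply V A) p -
      (vf_apply A (vf_apply V W) p - vf_apply A (vf_apply W V) p)"
  proof -
    have "vf_apply A (lie_bracket V W) p = vf_apply A (vf_apply V W) p - vf_apply A (vf_apply W V) p"
      unfolding lie_bracket_def[abs_def] using sm by (intro vf_apply_diff d) auto
    then show ?thesis
      using vf_apply_lie_bracket[OF assms(1-4,9)] by (simp add: lie_bracket_def[of _ A])
  qed
  also have "\<dots> = (vf_apply V b p - vf_apply W a p) *\<^sub>R A p +
      b p *\<^sub>R (vf_apply V A p - vf_apply A V p) - a p *\<^sub>R (vf_apply W A p - vf_apply A W p)"
  proof -
    have "vf_apply V (vf_apply A W) p = vf_apply A (vf_apply V W) p + a p *\<^sub>R vf_apply A W p"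
      "vf_apply W (vf_apply A V) p = vf_apply A (vf_apply W V) p + b p *\<^sub>R vf_apply A V p"
      using bracket_apply(1)[OF sm(3)] bracket_apply(2)[OF sm(2)] by (simp_all add: algebra_simps)
    then show ?thesis
      by (simp add: V W algebra_simps)
  qed
  also have "\<dots> = (vf_apply V b p - vf_apply W a p) *\<^sub>R A p"
    using A_V[OF \<open>p \<in> S\<close>] A_W[OF \<open>p \<in> S\<close>] by simp
  finally show ?thesis .
qed

section \<open>Prolongations\<close>

lemma bounded_linear_to_base: "bounded_linear to_base"
  unfolding to_base_def case_prod_beta
  by (intro bounded_linear_Pair bounded_linear_fst bounded_linear_compose[OF bounded_linear_fst bounded_linear_snd])

lemma to_base_prolong2: "to_base (prolong2 v p) = v (to_base p)"
  by (cases p) (simp add: to_base_def prolong2_def)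

lemma vf_apply_compose_linear:
  assumes "bounded_linear L" "f differentiable (at (L p))"
  shows "vf_apply X (\<lambda>q. f (L q)) p = frechet_derivative f (at (L p)) (L (X p))"
  by (simp only: vf_apply_def frechet_derivative_at[OF has_derivative_compose_linear[OF assms], symmetric])

lemma vf_apply_bounded_linear: "bounded_linear L \<Longrightarrow> vf_apply X L p = L (X p)"
  by (simp only: vf_apply_def frechet_derivative_at[OF bounded_linear_imp_has_derivative, symmetric])

lemma lie_bracket_component:
  assumes "bounded_linear L" "X differentiable (at p)" "Y differentiable (at p)"
  shows "L (lie_bracket X Y p) = vf_apply X (\<lambda>q. L (Y q)) p - vf_apply Y (\<lambda>q. L (X q)) p"
  using assms by (simp only: lie_bracket_def vf_apply_linear linear_diff[OF bounded_linear.linear])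

text \<open>The total derivative is an ordinary derivative of the pullback f o L along a smooth
  field on jet space.\<close>

lemma smooth_on_total_deriv0:
  assumes "smooth_on M f" "open S" "\<And>q. q \<in> S \<Longrightarrow> (fst q, fst (snd q)) \<in> M"
  shows "smooth_on S (total_deriv0 f)"
proof -
  define L where "L = (\<lambda>q :: jet1. (fst q, fst (snd q)))"
  have L: "bounded_linear L"
    unfolding L_def
    by (intro bounded_linear_Pair bounded_linear_fst bounded_linear_compose[OF bounded_linear_fst bounded_linear_snd])
  have LS: "L ` S \<subseteq> M"
    using assms(3) by (auto simp: L_def)
  \<comment> \<open>The last component is a filler: f o L does not depend on that
    coordinate.\<close>
  have X: "smooth_on S (\<lambda>q. (1, snd (snd q), 0 :: real))"
    by (intro smooth_on_Pair smooth_on_const smooth_on_snd smooth_on_id assms(2))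
  have "smooth_on S (vf_apply (\<lambda>q. (1, snd (snd q), 0)) (\<lambda>q. f (L q)))"
    by (rule smooth_on_vf_apply[OF assms(2) X smooth_on_compose_linear[OF L assms(2) LS assms(1)]])
  moreover have "vf_apply (\<lambda>q. (1, snd (snd q), 0)) (\<lambda>q. f (L q)) q = total_deriv0 f q" if "q \<in> S" for q
  proof -
    have "L q \<in> M" using LS that by blast
    from vf_apply_compose_linear[OF L smooth_on_differentiable[OF assms(1) this]]
    show ?thesis by (simp add: total_deriv0_def L_def case_prod_beta)
  qed
  ultimately show ?thesis
    using smooth_on_cong[OF assms(2)] by blast
qed

lemma smooth_on_total_deriv1:
  assumes "smooth_on M f" "open S" "\<And>q. q \<in> S \<Longrightarrow> (fst q, fst (snd q), fst (snd (snd q))) \<in> M"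
  shows "smooth_on S (total_deriv1 f)"
proof -
  define L where "L = (\<lambda>q :: jet2. (fst q, fst (snd q), fst (snd (snd q))))"
  have L: "bounded_linear L"
    unfolding L_def
    by (intro bounded_linear_Pair bounded_linear_fst bounded_linear_compose[OF bounded_linear_fst]
        bounded_linear_compose[OF bounded_linear_snd] bounded_linear_snd)
  have LS: "L ` S \<subseteq> M"
    using assms(3) by (auto simp: L_def)
  have X: "smooth_on S (\<lambda>q. (1, fst (snd (snd q)), snd (snd (snd q)), 0 :: real))"
    by (intro smooth_on_Pair smooth_on_const smooth_on_fst smooth_on_snd smooth_on_id assms(2))
  have "smooth_on S (vf_apply (\<lambda>q. (1, fst (snd (snd q)), snd (snd (snd q)), 0)) (\<lambda>q. f (L q)))"
    by (rule smooth_on_vf_apply[OF assms(2) X smooth_on_compose_linear[OF L assms(2) LS assms(1)]])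
  moreover have "vf_apply (\<lambda>q. (1, fst (snd (snd q)), snd (snd (snd q)), 0)) (\<lambda>q. f (L q)) q = total_deriv1 f q"
    if "q \<in> S" for q
  proof -
    have "L q \<in> M" using LS that by blast
    from vf_apply_compose_linear[OF L smooth_on_differentiable[OF assms(1) this]]
    show ?thesis by (simp add: total_deriv1_def L_def case_prod_beta)
  qed
  ultimately show ?thesis
    using smooth_on_cong[OF assms(2)] by blast
qed

lemma smooth_on_prolong2:
  assumes "open M" "smooth_on M v" "open D" "to_base ` D \<subseteq> M"
  shows "smooth_on D (prolong2 v)"
proof -
  \<comment> \<open>The cylinder over M in (x, u, u1)-space. The first prolongation coefficient is
    differentiated again, so it must be smooth on an open set of that space, not just along
    D.\<close>
  define J where "J = (\<lambda>q :: jet1. (fst q, fst (snd q))) -` M"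
  have "open J"
    unfolding J_def by (intro open_vimage assms(1) continuous_intros)
  have base: "(fst p, fst (snd p)) \<in> M" if "p \<in> D" for p
    using assms(4) that by (force simp: to_base_def case_prod_beta)
  have comps: "smooth_on M (\<lambda>q. fst (v q))" "smooth_on M (\<lambda>q. snd (v q))"
    by (intro smooth_on_fst smooth_on_snd assms(1,2))+
  have total0: "smooth_on J (total_deriv0 f)" if "smooth_on M f" for f
    using that by (rule smooth_on_total_deriv0[OF _ \<open>open J\<close>]) (simp add: J_def)
  have coeff1: "smooth_on J (prolong_coeff1 v)"
  proof -
    have "smooth_on J (\<lambda>q. total_deriv0 (\<lambda>q. snd (v q)) q - snd (snd q) * total_deriv0 (\<lambda>q. fst (v q)) q)"
      by (intro smooth_on_diff smooth_on_mult smooth_on_snd smooth_on_id total0 comps \<open>open J\<close>)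
    then show ?thesis
      by (simp add: prolong_coeff1_def case_prod_beta')
  qed
  let ?L = "\<lambda>p :: jet2. (fst p, fst (snd p), fst (snd (snd p)))"
  have L: "bounded_linear ?L"
    by (intro bounded_linear_Pair bounded_linear_fst bounded_linear_compose[OF bounded_linear_fst]
        bounded_linear_compose[OF bounded_linear_snd] bounded_linear_snd)
  have DJ: "?L p \<in> J" if "p \<in> D" for p
    using base[OF that] by (simp add: J_def)
  then have DJ': "?L ` D \<subseteq> J" by auto
  have coeff2: "smooth_on D (prolong_coeff2 v)"
  proof -
    have "smooth_on D (\<lambda>p. total_deriv1 (prolong_coeff1 v) p -
        snd (snd (snd p)) * total_deriv0 (\<lambda>q. fst (v q)) (?L p))"
      by (intro smooth_on_diff smooth_on_mult smooth_on_snd smooth_on_id assms(3)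
          smooth_on_total_deriv1[OF coeff1] DJ
          smooth_on_compose_linear[OF L assms(3) DJ' total0[OF comps(1)]])
    then show ?thesis
      by (simp add: prolong_coeff2_def case_prod_beta')
  qed
  have "smooth_on D (\<lambda>p. v (to_base p))"
    by (rule smooth_on_compose_linear[OF bounded_linear_to_base assms(3,4,2)])
  then have "smooth_on D (\<lambda>p. (fst (v (to_base p)), snd (v (to_base p)), prolong_coeff1 v (?L p), prolong_coeff2 v p))"
    by (intro smooth_on_Pair smooth_on_fst smooth_on_snd assms(3) coeff2
        smooth_on_compose_linear[OF L assms(3) DJ' coeff1])
  then show ?thesis
    by (simp add: prolong2_def to_base_def case_prod_beta')
qed

text \<open>\<open>prolong2 v\<close> projects to v under \<open>to_base\<close>, and brackets of
  projectable fields project to the bracket of the projections.\<close>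

lemma lie_bracket_prolong2_base:
  assumes "open M" "smooth_on M v" "smooth_on M w" "to_base p \<in> M"
    and "prolong2 v differentiable (at p)" "prolong2 w differentiable (at p)"
  shows "to_base (lie_bracket (prolong2 v) (prolong2 w) p) = lie_bracket v w (to_base p)"
proof -
  have "v differentiable (at (to_base p))" "w differentiable (at (to_base p))"
    using assms by (auto intro: smooth_on_differentiable)
  then show ?thesis
    by (simp add: lie_bracket_component[OF bounded_linear_to_base assms(5,6)] to_base_prolong2
        vf_apply_compose_linear[OF bounded_linear_to_base] lie_bracket_def[of v w]
        vf_apply_def[of v w] vf_apply_def[of w v])
qed

lemma smooth_on_ode_field:
  assumes "open D" "smooth_on D \<phi>"
  shows "smooth_on D (ode_field \<phi>)"
proof -
  have "smooth_on D (\<lambda>p. (1, fst (snd (snd p)), snd (snd (snd p)), \<phi> p))"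
    by (intro smooth_on_Pair smooth_on_const smooth_on_fst smooth_on_snd smooth_on_id assms)
  then show ?thesis
    by (simp add: ode_field_def case_prod_beta')
qed

section \<open>Vertical symmetries and brackets of prolongations\<close>

text \<open>The first three coefficients of A are 1, u1, u2. Once a component of U vanishes, the
  same component of [U, A] is U applied to that coefficient: 0 for the first, and the next component
  of U for the other two.\<close>

lemma vertical_symmetry_trivial:
  assumes "open D" "smooth_on D \<phi>" "smooth_on D U"
    and base: "\<And>p. p \<in> D \<Longrightarrow> to_base (U p) = 0"
    and bracket: "\<And>p. p \<in> D \<Longrightarrow> lie_bracket U (ode_field \<phi>) p = c p *\<^sub>R ode_field \<phi> p"
    and "p \<in> D"
  shows "U p = 0"
proof -
  have A: "smooth_on D (ode_field \<phi>)"
    by (rule smooth_on_ode_field[OF assms(1,2)])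
  \<comment> \<open>The component must vanish on all of D, not only at p, for its derivative along A
    to vanish; hence each later fact is proved throughout D.\<close>
  have component: "vf_apply U (\<lambda>q. L (ode_field \<phi> q)) p = L (c p *\<^sub>R ode_field \<phi> p)"
    if L: "bounded_linear L" and zero: "\<And>q. q \<in> D \<Longrightarrow> L (U q) = 0" and p: "p \<in> D"
    for L :: "jet2 \<Rightarrow> real" and p
  proof -
    have U': "U differentiable (at p)" "ode_field \<phi> differentiable (at p)"
      using smooth_on_differentiable[OF _ p] assms(3) A by auto
    have "vf_apply (ode_field \<phi>) (\<lambda>q. L (U q)) p = vf_apply (ode_field \<phi>) (\<lambda>q. 0) p"
      using zero smooth_on_differentiable[OF smooth_on_linear[OF L assms(1,3)] p]
      by (rule vf_apply_cong[OF assms(1) p, rotated])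
    then show ?thesis
      using lie_bracket_component[OF L U'] bracket[OF p] by (simp add: vf_apply_const)
  qed
  have lin: "bounded_linear (\<lambda>q :: jet2. fst (snd q))" "bounded_linear (\<lambda>q :: jet2. fst (snd (snd q)))"
    "bounded_linear (\<lambda>q :: jet2. snd (snd (snd q)))"
    by (intro bounded_linear_compose[OF bounded_linear_fst] bounded_linear_compose[OF bounded_linear_snd]
        bounded_linear_snd)+
  have U1: "fst (U q) = 0" and U2: "fst (snd (U q)) = 0" if "q \<in> D" for q
    using base[OF that] by (auto simp: to_base_def case_prod_beta zero_prod_def)
  have c: "c q = 0" if "q \<in> D" for q
    using component[OF bounded_linear_fst U1 that]
    by (simp add: ode_field_def case_prod_beta vf_apply_const)
  have U3: "fst (snd (snd (U q))) = 0" if "q \<in> D" for q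
    using component[OF lin(1) U2 that] c[OF that]
    by (simp add: ode_field_def case_prod_beta vf_apply_bounded_linear[OF lin(2)])
  have "snd (snd (snd (U q))) = 0" if "q \<in> D" for q
    using component[OF lin(2) U3 that] c[OF that]
    by (simp add: ode_field_def case_prod_beta vf_apply_bounded_linear[OF lin(3)])
  with U1 U2 U3 \<open>p \<in> D\<close> show ?thesis
    by (simp add: prod_eq_iff)
qed

lemma lie_bracket_prolong2:
  assumes "open D" "open M" "to_base ` D \<subseteq> M" "smooth_on D \<phi>"
    and sm: "smooth_on M v" "smooth_on M w" "smooth_on M z"
    and sym: "lie_point_symmetry D \<phi> v" "lie_point_symmetry D \<phi> w" "lie_point_symmetry D \<phi> z"
    and vw: "\<And>q. q \<in> M \<Longrightarrow> lie_bracket v w q = k *\<^sub>R z q"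
    and "p \<in> D"
  shows "lie_bracket (prolong2 v) (prolong2 w) p = k *\<^sub>R prolong2 z p"
proof -
  let ?A = "ode_field \<phi>"
  \<comment> \<open>\<open>mu v\<close> is the factor -A(xi) in the symmetry condition for
    v.\<close>
  define mu where "mu v p = - vf_apply ?A (\<lambda>p. fst (v (to_base p))) p" for v :: "base \<Rightarrow> base" and p
  define U where "U q = lie_bracket (prolong2 v) (prolong2 w) q - k *\<^sub>R prolong2 z q" for q
  have A: "smooth_on D ?A"
    by (rule smooth_on_ode_field[OF assms(1,4)])
  have mu: "smooth_on D (mu v)" if "smooth_on M v" for v
    unfolding mu_def
    by (intro smooth_on_minus smooth_on_vf_apply A assms(1) smooth_on_fst
        smooth_on_compose_linear[OF bounded_linear_to_base assms(1,3) that])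
  have bracket: "lie_bracket (prolong2 v) ?A q = mu v q *\<^sub>R ?A q"
    if "lie_point_symmetry D \<phi> v" "q \<in> D" for v q
    using that by (simp add: lie_point_symmetry_def mu_def)
  have pro: "smooth_on D (prolong2 v)" if "smooth_on M v" for v
    by (rule smooth_on_prolong2[OF assms(2) that assms(1,3)])
  have VW: "smooth_on D (lie_bracket (prolong2 v) (prolong2 w))"
    by (intro smooth_on_lie_bracket pro sm assms(1))
  have kZ: "smooth_on D (\<lambda>q. k *\<^sub>R prolong2 z q)"
    by (intro smooth_on_scaleR smooth_on_const pro sm assms(1))
  have "U p = 0"
  proof (rule vertical_symmetry_trivial[OF assms(1,4) _ _ _ \<open>p \<in> D\<close>])
    show "smooth_on D U"
      unfolding U_def by (rule smooth_on_diff[OF assms(1) VW kZ])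
    fix q assume q: "q \<in> D"
    then have qM: "to_base q \<in> M" using assms(3) by blast
    have "to_base (lie_bracket (prolong2 v) (prolong2 w) q) = k *\<^sub>R z (to_base q)"
      using lie_bracket_prolong2_base[OF assms(2) sm(1,2) qM]
        smooth_on_differentiable[OF pro q] sm vw[OF qM] by simp
    then show "to_base (U q) = 0"
      by (simp add: U_def to_base_prolong2 linear_diff[OF bounded_linear.linear[OF bounded_linear_to_base]]
          linear_scale[OF bounded_linear.linear[OF bounded_linear_to_base]])
    have "lie_bracket U ?A q = lie_bracket (lie_bracket (prolong2 v) (prolong2 w)) ?A q -
        lie_bracket (\<lambda>q. k *\<^sub>R prolong2 z q) ?A q"
      unfolding U_def using VW kZ A q
      by (intro lie_bracket_diff_left) (auto intro: smooth_on_differentiable)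
    also have "lie_bracket (lie_bracket (prolong2 v) (prolong2 w)) ?A q =
        (vf_apply (prolong2 v) (mu w) q - vf_apply (prolong2 w) (mu v) q) *\<^sub>R ?A q"
      using bracket sym
      by (intro lie_bracket_of_symmetries[OF assms(1) pro[OF sm(1)] pro[OF sm(2)] A mu[OF sm(1)] mu[OF sm(2)]
            _ _ q]) auto
    also have "lie_bracket (\<lambda>q. k *\<^sub>R prolong2 z q) ?A q = (k * mu z q) *\<^sub>R ?A q"
      using lie_bracket_scaleR_left[of "\<lambda>q. k" q "prolong2 z" ?A] bracket[OF sym(3) q]
        smooth_on_differentiable[OF pro[OF sm(3)] q] smooth_on_differentiable[OF A q]
      by (simp add: vf_apply_const)
    finally show "lie_bracket U ?A q =
        (vf_apply (prolong2 v) (mu w) q - vf_apply (prolong2 w) (mu v) q - k * mu z q) *\<^sub>R ?A q"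
      by (simp add: scaleR_left_diff_distrib)
  qed
  then show ?thesis
    by (simp add: U_def)
qed

section \<open>Solvable structures\<close>

text \<open>Every bracket met below is a multiple of a single field, so the coefficients can be f at
  one index of that field and 0 elsewhere.\<close>

lemma vf_span_multiple:
  assumes "A \<in> set As" "smooth_on D f" "\<And>p. p \<in> D \<Longrightarrow> W p = f p *\<^sub>R A p"
  shows "W \<in> vf_span D As"
proof -
  from assms(1) obtain i where i: "i < length As" "As ! i = A"
    by (auto simp: in_set_conv_nth)
  let ?c = "\<lambda>j p. if j = i then f p else 0"
  have "W p = (\<Sum>j<length As. ?c j p *\<^sub>R (As ! j) p)" if "p \<in> D" for p
  proof -
    have "(\<Sum>j<length As. ?c j p *\<^sub>R (As ! j) p) = (\<Sum>j<length As. if j = i then f p *\<^sub>R A p else 0)"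
      using i by (intro sum.cong) auto
    then show ?thesis
      using i assms(3)[OF that] by simp
  qed
  moreover have "smooth_on D (?c j)" for j
    by (cases "j = i") (simp_all add: assms(2) smooth_on_const)
  ultimately show ?thesis
    unfolding vf_span_def by (intro CollectI exI[of _ ?c]) blast
qed

lemma lie_bracket_swap_in_vf_span:
  assumes "open D" "lie_bracket X Y \<in> vf_span D As"
  shows "lie_bracket Y X \<in> vf_span D As"
proof -
  from assms(2) obtain c where c: "\<forall>i<length As. smooth_on D (c i)"
    "\<forall>p\<in>D. lie_bracket X Y p = (\<Sum>i<length As. c i p *\<^sub>R (As ! i) p)"
    unfolding vf_span_def by blast
  have "lie_bracket Y X p = (\<Sum>i<length As. - c i p *\<^sub>R (As ! i) p)" if "p \<in> D" for p
    using c(2) that lie_bracket_swap[of Y X p] by (simp add: sum_negf)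
  moreover have "\<forall>i<length As. smooth_on D (\<lambda>p. - c i p)"
    using c(1) smooth_on_minus[OF assms(1)] by blast
  ultimately show ?thesis
    unfolding vf_span_def by (intro CollectI exI[of _ "\<lambda>i p. - c i p"]) blast
qed

text \<open>A lies in every system of the chain, and X in every system containing Y, so each bracket
  required lies along a field already present. Exchanging Y and Z only changes the sign of e, which
  makes one lemma serve both orders.\<close>

lemma solvable_structure_of_brackets:
  fixes A X Y Z :: "'a::euclidean_space \<Rightarrow> 'a"
  assumes dim: "DIM('a) = 4" and "open D"
    and sm: "smooth_on D A" "smooth_on D X" "smooth_on D Y" "smooth_on D Z"
    and ind: "vf_independent D [A, X, Y, Z]"
    and coeffs: "smooth_on D a" "smooth_on D b" "smooth_on D c" "smooth_on D e"
    and XA: "\<And>p. p \<in> D \<Longrightarrow> lie_bracket X A p = a p *\<^sub>R A p"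
    and YA: "\<And>p. p \<in> D \<Longrightarrow> lie_bracket Y A p = b p *\<^sub>R A p"
    and ZA: "\<And>p. p \<in> D \<Longrightarrow> lie_bracket Z A p = c p *\<^sub>R A p"
    and YX: "\<And>p. p \<in> D \<Longrightarrow> lie_bracket Y X p = 0"
    and ZX: "\<And>p. p \<in> D \<Longrightarrow> lie_bracket Z X p = 0"
    and ZY: "\<And>p. p \<in> D \<Longrightarrow> lie_bracket Z Y p = e p *\<^sub>R X p"
  shows "solvable_structure D [A] [X, Y, Z]"
proof -
  have spanA: "lie_bracket X A \<in> vf_span D As" "lie_bracket Y A \<in> vf_span D As"
    "lie_bracket Z A \<in> vf_span D As" if "A \<in> set As" for As
    using vf_span_multiple[OF that coeffs(1) XA] vf_span_multiple[OF that coeffs(2) YA]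
      vf_span_multiple[OF that coeffs(3) ZA] by auto
  \<comment> \<open>A vanishing bracket is counted as 0 times A.\<close>
  have zero: "W \<in> vf_span D As" if "A \<in> set As" "\<And>p. p \<in> D \<Longrightarrow> W p = 0" for W As
    using that by (intro vf_span_multiple[OF that(1) smooth_on_const[of D 0]]) simp
  have span0: "lie_bracket Y X \<in> vf_span D As" "lie_bracket Z X \<in> vf_span D As"
    "lie_bracket W W \<in> vf_span D As" if "A \<in> set As" for As W
    using zero[OF that YX] zero[OF that ZX] zero[OF that lie_bracket_self] by auto
  have spanX: "lie_bracket Z Y \<in> vf_span D As" if "X \<in> set As" for As
    using vf_span_multiple[OF that coeffs(4) ZY] .
  note spans = spanA span0 spanX spanA[THEN lie_bracket_swap_in_vf_span[OF \<open>open D\<close>]]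
    span0[THEN lie_bracket_swap_in_vf_span[OF \<open>open D\<close>]]
    spanX[THEN lie_bracket_swap_in_vf_span[OF \<open>open D\<close>]]
  have inv: "in_involution D [A]" "in_involution D [A, X]" "in_involution D [A, X, Y]"
    "in_involution D [A, X, Y, Z]"
    unfolding in_involution_def by (simp_all add: spans)
  have indep: "vf_independent D [A]" "vf_independent D [X, Y, Z]" "vf_independent D [A, X]"
    "vf_independent D [A, X, Y]"
  proof -
    have "distinct [A p, X p, Y p, Z p]" "independent {A p, X p, Y p, Z p}" if "p \<in> D" for p
      using ind that by (auto simp: vf_independent_def)
    moreover have "independent {A p} \<and> independent {X p, Y p, Z p} \<and> independent {A p, X p} \<and>
        independent {A p, X p, Y p}" if "p \<in> D" for p
      by (intro conjI independent_mono[OF calculation(2)[OF that]]) auto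
    ultimately show "vf_independent D [A]" "vf_independent D [X, Y, Z]" "vf_independent D [A, X]"
      "vf_independent D [A, X, Y]"
      by (auto simp: vf_independent_def)
  qed
  have ivl: "{1..length [X, Y, Z]} = {1, 2, 3}" "{1..<length [X, Y, Z]} = {1, 2}"
    by auto
  show ?thesis
    unfolding solvable_structure_def symmetry_of_def ivl
    using inv indep ind dim sm
    by (simp add: spans numeral_2_eq_2 numeral_3_eq_3)
qed

lemma vf_independent_scale:
  assumes "vf_independent D [A, Y, Z, X]" "\<And>p. p \<in> D \<Longrightarrow> f p \<noteq> 0" "\<And>p. p \<in> D \<Longrightarrow> g p \<noteq> 0"
  shows "vf_independent D [A, X, \<lambda>p. f p *\<^sub>R Y p, \<lambda>p. g p *\<^sub>R Z p]"
proof -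
  \<comment> \<open>If r y were in span B, so would be y = (1/r)(r y).\<close>
  have scale: "r *\<^sub>R y \<notin> B \<and> independent (insert (r *\<^sub>R y) B)"
    if "independent (insert y B)" "y \<notin> B" "r \<noteq> 0" for r :: real and y :: 'a and B
  proof -
    have "independent B" "y \<notin> span B"
      using that by (auto simp: independent_insert)
    moreover have "r *\<^sub>R y \<notin> span B"
      using \<open>y \<notin> span B\<close> span_scale[of "r *\<^sub>R y" B "1 / r"] \<open>r \<noteq> 0\<close> by auto
    ultimately show ?thesis
      using span_base[of "r *\<^sub>R y" B] by (auto simp: independent_insert)
  qed
  show ?thesis
    unfolding vf_independent_def
  proof
    fix p assume "p \<in> D"
    with assms have "distinct [A p, Y p, Z p, X p]" "independent {A p, Y p, Z p, X p}"
      "f p \<noteq> 0" "g p \<noteq> 0"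
      by (auto simp: vf_independent_def)
    \<comment> \<open>One vector is scaled at a time; the second application works over a set that
      already contains the scaled first vector.\<close>
    moreover from this have 1: "f p *\<^sub>R Y p \<notin> {A p, X p, Z p}"
      "independent (insert (f p *\<^sub>R Y p) {A p, X p, Z p})"
      using scale[of "Y p" "{A p, X p, Z p}" "f p"] by (auto simp: insert_commute)
    ultimately have "g p *\<^sub>R Z p \<notin> {A p, X p, f p *\<^sub>R Y p}"
      "independent (insert (g p *\<^sub>R Z p) {A p, X p, f p *\<^sub>R Y p})"
      using scale[of "Z p" "{A p, X p, f p *\<^sub>R Y p}" "g p"] by (auto simp: insert_commute)
    with 1 \<open>distinct [A p, Y p, Z p, X p]\<close>
    show "distinct (map (\<lambda>X. X p) [A, X, \<lambda>p. f p *\<^sub>R Y p, \<lambda>p. g p *\<^sub>R Z p]) \<and>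
        independent (set (map (\<lambda>X. X p) [A, X, \<lambda>p. f p *\<^sub>R Y p, \<lambda>p. g p *\<^sub>R Z p]))"
      by (auto simp: insert_commute)
  qed
qed

theorem theorem4p3:
  fixes D :: "jet2 set" and M :: "base set"
    and \<phi> F1 F2 :: "jet2 \<Rightarrow> real" and v1 v2 v3 :: "base \<Rightarrow> base"
  assumes "open D" and "simply_connected D"
    and "open M" and "simply_connected M" and "to_base ` D \<subseteq> M"
    and "smooth_on D \<phi>" and "smooth_on D F1" and "smooth_on D F2"
    and "smooth_on M v1" and "smooth_on M v2" and "smooth_on M v3"
    and "lie_point_symmetry D \<phi> v1" and "lie_point_symmetry D \<phi> v2" and "lie_point_symmetry D \<phi> v3"
    and "sl2_basis M v1 v2 v3"
    and "vf_independent D [ode_field \<phi>, prolong2 v1, prolong2 v2, prolong2 v3]"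
    and "\<And>p. p \<in> D \<Longrightarrow> F1 p \<noteq> 0" and "\<And>p. p \<in> D \<Longrightarrow> F2 p \<noteq> 0"
    and "\<And>p. p \<in> D \<Longrightarrow> vf_apply (prolong2 v3) F1 p = F1 p"
    and "\<And>p. p \<in> D \<Longrightarrow> vf_apply (ode_field \<phi>) F1 p = 0"
    and "\<And>p. p \<in> D \<Longrightarrow> vf_apply (prolong2 v2) F1 p = 0"
    and "\<And>p. p \<in> D \<Longrightarrow> vf_apply (prolong2 v3) F2 p = - F2 p"
    and "\<And>p. p \<in> D \<Longrightarrow> vf_apply (ode_field \<phi>) F2 p = 0"
    and "\<And>p. p \<in> D \<Longrightarrow> vf_apply (prolong2 v1) F2 p = 0"
  shows "solvable_structure D [ode_field \<phi>]
           [prolong2 v3, \<lambda>p. F1 p *\<^sub>R prolong2 v1 p, \<lambda>p. F2 p *\<^sub>R prolong2 v2 p] \<and>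
         solvable_structure D [ode_field \<phi>]
           [prolong2 v3, \<lambda>p. F2 p *\<^sub>R prolong2 v2 p, \<lambda>p. F1 p *\<^sub>R prolong2 v1 p]"
proof -
  let ?A = "ode_field \<phi>"
  let ?V1 = "prolong2 v1" and ?V2 = "prolong2 v2" and ?V3 = "prolong2 v3"
  note D = \<open>open D\<close> and F = assms(17-24)
  have A: "smooth_on D ?A"
    by (rule smooth_on_ode_field[OF D assms(6)])
  have V: "smooth_on D ?V1" "smooth_on D ?V2" "smooth_on D ?V3"
    using smooth_on_prolong2[OF assms(3) _ D assms(5)] assms(9-11) by blast+
  have FV: "smooth_on D (\<lambda>p. F1 p *\<^sub>R ?V1 p)" "smooth_on D (\<lambda>p. F2 p *\<^sub>R ?V2 p)"
    by (rule smooth_on_scaleR[OF D assms(7) V(1)], rule smooth_on_scaleR[OF D assms(8) V(2)])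
  define mu where "mu v p = - vf_apply ?A (\<lambda>p. fst (v (to_base p))) p" for v :: "base \<Rightarrow> base" and p
  have mu: "smooth_on D (mu v)" if "smooth_on M v" for v
    unfolding mu_def
    by (intro smooth_on_minus smooth_on_vf_apply A D smooth_on_fst
        smooth_on_compose_linear[OF bounded_linear_to_base D assms(5) that])
  have VA: "lie_bracket ?V1 ?A p = mu v1 p *\<^sub>R ?A p" "lie_bracket ?V2 ?A p = mu v2 p *\<^sub>R ?A p"
    "lie_bracket ?V3 ?A p = mu v3 p *\<^sub>R ?A p" if "p \<in> D" for p
    using assms(12-14) that by (simp_all add: lie_point_symmetry_def mu_def)
  \<comment> \<open>The factors 1 fit the relations to the form k z expected by
    \<open>lie_bracket_prolong2\<close>.\<close>
  have sl2: "\<And>q. q \<in> M \<Longrightarrow> lie_bracket v1 v3 q = 1 *\<^sub>R v1 q"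
    "\<And>q. q \<in> M \<Longrightarrow> lie_bracket v1 v2 q = 2 *\<^sub>R v3 q"
    "\<And>q. q \<in> M \<Longrightarrow> lie_bracket v3 v2 q = 1 *\<^sub>R v2 q"
    using assms(15) by (auto simp: sl2_basis_def)
  note prolong = lie_bracket_prolong2[OF D assms(3,5,6)]
  have V13: "lie_bracket ?V1 ?V3 p = ?V1 p" and V12: "lie_bracket ?V1 ?V2 p = 2 *\<^sub>R ?V3 p"
    and V32: "lie_bracket ?V3 ?V2 p = ?V2 p" if "p \<in> D" for p
    using prolong[OF assms(9,11,9,12,14,12) sl2(1) that] prolong[OF assms(9,10,11,12,13,14) sl2(2) that]
      prolong[OF assms(11,10,10,14,13,13) sl2(3) that] by simp_all
  have diff: "F1 differentiable (at p)" "F2 differentiable (at p)" "?V1 differentiable (at p)"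
    "?V2 differentiable (at p)" "?V3 differentiable (at p)" "?A differentiable (at p)"
    "(\<lambda>p. F1 p *\<^sub>R ?V1 p) differentiable (at p)" if "p \<in> D" for p
    using smooth_on_differentiable[OF _ that] assms(7,8) V A FV by blast+
  have F1A: "lie_bracket (\<lambda>p. F1 p *\<^sub>R ?V1 p) ?A p = (F1 p * mu v1 p) *\<^sub>R ?A p"
    and F2A: "lie_bracket (\<lambda>p. F2 p *\<^sub>R ?V2 p) ?A p = (F2 p * mu v2 p) *\<^sub>R ?A p"
    and F1V3: "lie_bracket (\<lambda>p. F1 p *\<^sub>R ?V1 p) ?V3 p = 0"
    and F2V3: "lie_bracket (\<lambda>p. F2 p *\<^sub>R ?V2 p) ?V3 p = 0" if "p \<in> D" for p
    using diff[OF that] VA[OF that] F that V13[OF that] V32[OF that] lie_bracket_swap[of ?V2 ?V3 p]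
    by (simp_all add: lie_bracket_scaleR_left)
  \<comment> \<open>[F2 v2, Y] = F2 [v2, Y] - Y(F2) v2 with Y = F1 v1. Here Y(F2) = F1 v1(F2) = 0,
    and v2(F1) = 0 reduces [Y, v2] to 2 F1 v3.\<close>
  have F21: "lie_bracket (\<lambda>p. F2 p *\<^sub>R ?V2 p) (\<lambda>p. F1 p *\<^sub>R ?V1 p) p = (- 2 * F1 p * F2 p) *\<^sub>R ?V3 p"
    if "p \<in> D" for p
  proof -
    have "lie_bracket (\<lambda>p. F1 p *\<^sub>R ?V1 p) ?V2 p = (2 * F1 p) *\<^sub>R ?V3 p"
      using diff[OF that] F that V12[OF that] by (simp add: lie_bracket_scaleR_left)
    moreover have "vf_apply (\<lambda>p. F1 p *\<^sub>R ?V1 p) F2 p = 0"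
      using diff[OF that] F that by (simp add: vf_apply_field_scaleR)
    ultimately show ?thesis
      using diff[OF that] lie_bracket_swap[of ?V2 "\<lambda>p. F1 p *\<^sub>R ?V1 p" p]
      by (simp add: lie_bracket_scaleR_left algebra_simps)
  qed
  have F12: "lie_bracket (\<lambda>p. F1 p *\<^sub>R ?V1 p) (\<lambda>p. F2 p *\<^sub>R ?V2 p) p = (2 * F1 p * F2 p) *\<^sub>R ?V3 p"
    if "p \<in> D" for p
    using F21[OF that] lie_bracket_swap[of "\<lambda>p. F1 p *\<^sub>R ?V1 p" "\<lambda>p. F2 p *\<^sub>R ?V2 p" p] by simp
  have coeffs: "smooth_on D (\<lambda>p. F1 p * mu v1 p)" "smooth_on D (\<lambda>p. F2 p * mu v2 p)"
    "smooth_on D (\<lambda>p. - 2 * F1 p * F2 p)" "smooth_on D (\<lambda>p. 2 * F1 p * F2 p)"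
    by (intro smooth_on_mult smooth_on_const mu D assms(7-11))+
  \<comment> \<open>A zero of F1 or F2 would destroy pointwise independence; this is where their
    nonvanishing enters.\<close>
  have ind: "vf_independent D [?A, ?V3, \<lambda>p. F1 p *\<^sub>R ?V1 p, \<lambda>p. F2 p *\<^sub>R ?V2 p]"
    by (rule vf_independent_scale[OF assms(16-18)])
  then have ind': "vf_independent D [?A, ?V3, \<lambda>p. F2 p *\<^sub>R ?V2 p, \<lambda>p. F1 p *\<^sub>R ?V1 p]"
    by (auto simp: vf_independent_def insert_commute)
  have dim: "DIM(jet2) = 4" by simp
  show ?thesis
    using solvable_structure_of_brackets[OF dim D A V(3) FV(1,2) ind mu[OF assms(11)] coeffs(1,2,3)
        VA(3) F1A F2A F1V3 F2V3 F21]
      solvable_structure_of_brackets[OF dim D A V(3) FV(2,1) ind' mu[OF assms(11)] coeffs(2,1,4)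
        VA(3) F2A F1A F2V3 F1V3 F12]
    by blast
qed

end
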